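(* Let $a>0$ and let $\phi(z)=cz+d$ where $c\in\mathbb{R}$ with $0<|c|\leq 1$ and $d\in\mathbb{C}$. Then the composition operator $C_\phi f=f\circ\phi$ is absolutely Cesàro bounded on $B^2_a$ if and only if either $c=-1$ (with $d\in\mathbb{C}$ arbitrary), or $c=1$ and $d\in\mathbb{R}$.
   Context: For $a>0$, the Paley-Wiener space $B^2_a$ is the Hilbert space of all entire functions of exponential type less than or equal to $a$ whose restriction to $\mathbb{R}$ belongs to $L^2(\mathbb{R})$, with inner product $\langle f,g\rangle=\int_{-\infty}^{\infty}f(t)\overline{g(t)}\,dt$ and norm $\|\cdot\|_a$. For symbols $\phi(z)=cz+d$ ($z\in\mathbb{C}$) with $c\in\mathbb{R}$, $0<|c|\leq1$, $d\in\mathbb{C}$, the operator $C_\phi$ is a bounded linear operator on $B^2_a$. A continuous linear operator $T$ on a complex Banach space $E$ is absolutely Cesàro bounded if there exists a constant $C>0$ such that $\sup\left\{\frac1n\sum_{j=1}^n\|T^jx\|: n\in\mathbb{N}\right\}\leq C\|x\|$ for all $x\in E$, where $\mathbb{N}$ is the set of positive integers. *)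

theory Defs
  imports "HOL-Complex_Analysis.Complex_Analysis"
begin

definition exp_type_le :: "real \<Rightarrow> (complex \<Rightarrow> complex) \<Rightarrow> bool" where
  "exp_type_le a f \<longleftrightarrow> (\<forall>\<epsilon>>0. \<exists>K. \<forall>z. norm (f z) \<le> K * exp ((a + \<epsilon>) * norm z))"

text \<open>The restriction of an entire function to the real line is continuous, hence measurable, so
  membership in \<open>L\<^sup>2\<close> amounts to integrability of the squared modulus.\<close>

definition paley_wiener :: "real \<Rightarrow> (complex \<Rightarrow> complex) set" where
  "paley_wiener a = {f. f holomorphic_on UNIV \<and> exp_type_le a f \<and>
     integrable lborel (\<lambda>t::real. (norm (f (complex_of_real t)))\<^sup>2)}"

definition pw_inner :: "(complex \<Rightarrow> complex) \<Rightarrow> (complex \<Rightarrow> complex) \<Rightarrow> complex" where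
  "pw_inner f g = (LINT t|lborel. f (complex_of_real t) * cnj (g (complex_of_real t)))"

definition pw_norm :: "(complex \<Rightarrow> complex) \<Rightarrow> real" where
  "pw_norm f = sqrt (Re (pw_inner f f))"

definition composition_op :: "('s \<Rightarrow> 's) \<Rightarrow> ('s \<Rightarrow> complex) \<Rightarrow> ('s \<Rightarrow> complex)" where
  "composition_op \<phi> f = f \<circ> \<phi>"

text \<open>A complex Banach space of functions is given by its carrier \<open>E\<close> and norm \<open>N\<close>, with the pointwise
  operations. A continuous linear operator on it has to map \<open>E\<close> into \<open>E\<close>; in particular this rules out
  that \<open>N\<close> is evaluated outside \<open>E\<close>, where it has no meaning (\<open>pw_norm f = 0\<close> if \<open>f\<close> is not square
  integrable).\<close>

definition bounded_linear_op_on ::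
  "('s \<Rightarrow> complex) set \<Rightarrow> (('s \<Rightarrow> complex) \<Rightarrow> real) \<Rightarrow> (('s \<Rightarrow> complex) \<Rightarrow> ('s \<Rightarrow> complex)) \<Rightarrow> bool" where
  "bounded_linear_op_on E N T \<longleftrightarrow>
     (\<forall>f\<in>E. T f \<in> E) \<and>
     (\<forall>f\<in>E. \<forall>g\<in>E. T (\<lambda>s. f s + g s) = (\<lambda>s. T f s + T g s)) \<and>
     (\<forall>k. \<forall>f\<in>E. T (\<lambda>s. k * f s) = (\<lambda>s. k * T f s)) \<and>
     (\<exists>K. \<forall>f\<in>E. N (T f) \<le> K * N f)"

text \<open>The supremum is taken in the extended reals, so that it is infinite when the averages are
  unbounded.\<close>

definition absolutely_cesaro_bounded ::
  "('s \<Rightarrow> complex) set \<Rightarrow> (('s \<Rightarrow> complex) \<Rightarrow> real) \<Rightarrow> (('s \<Rightarrow> complex) \<Rightarrow> ('s \<Rightarrow> complex)) \<Rightarrow> bool" where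
  "absolutely_cesaro_bounded E N T \<longleftrightarrow>
     bounded_linear_op_on E N T \<and>
     (\<exists>C>0. \<forall>f\<in>E. (SUP n\<in>{1::nat..}. ereal (1 / real n * (\<Sum>j=1..n. N ((T ^^ j) f)))) \<le> ereal (C * N f))"

end

theory Submission
  imports Defs "HOL-Probability.Sinc_Integral" "HOL-Real_Asymp.Real_Asymp"
begin

text \<open>The \<open>n\<close>-th power of \<open>C\<^sub>\<phi>\<close> is composition with \<open>z \<mapsto> c\<^sup>n z + d\<^sub>n\<close>, where
  \<open>d\<^sub>n = d (1 + c + \<dots> + c\<^sup>n\<^sup>-\<^sup>1)\<close>. If \<open>c = -1\<close>, or \<open>c = 1\<close> and \<open>d\<close> is real, then \<open>\<bar>Im d\<^sub>n\<bar> \<le> \<bar>Im d\<bar>\<close>, and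
  the Plancherel-Polya inequality, \<open>\<integral> \<bar>f (t + i y)\<bar>\<^sup>2 dt \<le> exp (2 b \<bar>y\<bar>) \<integral> \<bar>f t\<bar>\<^sup>2 dt\<close> for \<open>b > a\<close>, makes
  \<open>C\<^sub>\<phi>\<close> power bounded. This inequality follows by duality from Phragmen-Lindelof: an entire function of
  exponential type that is bounded by \<open>M\<close> on the real line is bounded by \<open>M exp (b \<bar>y\<bar>)\<close> at height \<open>y\<close>.

  In the remaining cases take \<open>f z = sin (a z) / z\<close>. Absolute Cesaro boundedness would force
  \<open>\<parallel>C\<^sub>\<phi>\<^sup>n f\<parallel> = O(n)\<close>, but \<open>\<parallel>C\<^sub>\<phi>\<^sup>n f\<parallel>\<^sup>2 = \<bar>c\<bar>\<^sup>-\<^sup>n \<integral> \<bar>f (s + i Im d\<^sub>n)\<bar>\<^sup>2 ds\<close> grows exponentially: through the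
  factor \<open>\<bar>c\<bar>\<^sup>-\<^sup>n\<close> if \<open>\<bar>c\<bar> < 1\<close>, since then \<open>Im d\<^sub>n\<close> stays bounded, and through
  \<open>\<bar>sin (a z)\<bar>\<^sup>2 \<approx> exp (2 a \<bar>Im z\<bar>) / 4\<close> if \<open>c = 1\<close>, since then \<open>Im d\<^sub>n = n Im d\<close>.\<close>

section \<open>Phragmen-Lindelof for functions of exponential type\<close>

text \<open>Cutting \<open>S\<close> down to a ball containing \<open>w\<close> makes it compact.
  The frontier of the cut set lies on the frontier of \<open>S\<close> or on a sphere of radius at
  least \<open>R\<close>, so \<open>fr\<close> or \<open>far\<close> applies there.\<close>

lemma max_modulus_unbounded:
  fixes S :: "complex set"
  assumes "closed S" and cont: "continuous_on S f" and hol: "f holomorphic_on interior S"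
    and fr: "\<And>z. z \<in> frontier S \<Longrightarrow> norm (f z) \<le> B"
    and far: "\<And>z. z \<in> S \<Longrightarrow> R \<le> norm z \<Longrightarrow> norm (f z) \<le> B"
    and "w \<in> S"
  shows "norm (f w) \<le> B"
proof -
  define T where "T = S \<inter> cball 0 (max R (norm w))"
  have "closed T" using \<open>closed S\<close> by (auto simp: T_def)
  show ?thesis
  proof (rule maximum_modulus_frontier[of f T])
    show "f holomorphic_on interior T"
      by (rule holomorphic_on_subset[OF hol]) (simp add: T_def interior_mono)
    show "continuous_on (closure T) f"
      using \<open>closed T\<close> by (auto simp: T_def intro: continuous_on_subset[OF cont])
    show "bounded T" by (auto simp: T_def)
    show "w \<in> T" using \<open>w \<in> S\<close> by (auto simp: T_def)
    fix z assume z: "z \<in> frontier T"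
    then have "z \<in> S"
      using \<open>closed T\<close> frontier_subset_closed unfolding T_def by blast
    from z have "z \<in> frontier S \<or> z \<in> frontier (cball 0 (max R (norm w)))"
      unfolding T_def using frontier_Int_subset by blast
    then show "norm (f z) \<le> B"
    proof
      assume "z \<in> frontier (cball 0 (max R (norm w)))"
      then have "R \<le> norm z" by (auto simp: frontier_cball)
      then show ?thesis using far \<open>z \<in> S\<close> by blast
    qed (rule fr)
  qed
qed

text \<open>With \<open>s = csqrt w = p + i q\<close> the product is \<open>s ^ 3\<close>. The
  hypothesis confines the argument of \<open>w\<close> to at most pi/4 in modulus, hence that of
  \<open>s ^ 3\<close> to at most 3 pi/8, where the cosine exceeds 1/4.\<close>

lemma Re_mult_csqrt_ge:
  assumes "\<bar>Im w\<bar> \<le> Re w"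
  shows "norm w * sqrt (norm w) \<le> 4 * Re (w * csqrt w)"
proof -
  define p q where "p = Re (csqrt w)" and "q = Im (csqrt w)"
  have s: "csqrt w = Complex p q" by (simp add: p_def q_def del: csqrt.simps)
  have w: "w = (Complex p q)\<^sup>2" using s power2_csqrt by metis
  have p: "0 \<le> p" using csqrt_principal[of w] by (auto simp: p_def)
  have "\<bar>2 * p * q\<bar> \<le> p\<^sup>2 - q\<^sup>2"
    using assms unfolding w by (simp add: power2_eq_square)
  then have pq: "2 * (p * \<bar>q\<bar>) \<le> p\<^sup>2 - \<bar>q\<bar>\<^sup>2" using p by (simp add: abs_mult)
  have nw: "norm w = p\<^sup>2 + q\<^sup>2"
    unfolding w norm_power by (simp add: cmod_def)
  have "\<bar>q\<bar> \<le> p / 2"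
  proof (rule ccontr)
    assume "\<not> ?thesis"
    then have q: "p < 2 * \<bar>q\<bar>" by simp
    have "p * p \<le> p * (2 * \<bar>q\<bar>)" using p q by (intro mult_left_mono) auto
    moreover have "0 < \<bar>q\<bar>\<^sup>2" using p q by auto
    ultimately show False using pq by (simp add: power2_eq_square)
  qed
  then have qp: "\<bar>q\<bar> * p \<le> p / 2 * p" "\<bar>q\<bar> * \<bar>q\<bar> \<le> p / 2 * \<bar>q\<bar>"
    using p by (intro mult_right_mono; simp)+
  then have q4: "4 * q\<^sup>2 \<le> p\<^sup>2"
    using mult.commute[of p "\<bar>q\<bar>"] by (simp add: power2_eq_square)
  \<comment> \<open>Feeding \<open>\<bar>q\<bar> \<le> p / 2\<close> back into \<open>pq\<close>
    improves the constant 4 to 5; with 4 alone the final estimate would fail.\<close>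
  have q5: "5 * q\<^sup>2 \<le> p\<^sup>2"
  proof -
    have "2 * (\<bar>q\<bar> * \<bar>q\<bar>) \<le> p * \<bar>q\<bar>" using qp by simp
    then show ?thesis using pq by (simp add: power2_eq_square)
  qed
  have "(5/4 * p)\<^sup>2 = 25/16 * p\<^sup>2" by (simp add: power_mult_distrib power_divide)
  then have "p\<^sup>2 + q\<^sup>2 \<le> (5/4 * p)\<^sup>2" using q4 zero_le_power2[of p] by linarith
  then have "sqrt (p\<^sup>2 + q\<^sup>2) \<le> sqrt ((5/4 * p)\<^sup>2)" by (rule real_sqrt_le_mono)
  then have "norm w * sqrt (norm w) \<le> (6/5 * p\<^sup>2) * (5/4 * p)"
    unfolding nw using q5 p by (intro mult_mono) auto
  also have "\<dots> = 3/2 * (p\<^sup>2 * p)" by simp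
  also have "\<dots> \<le> 4 * (p * (p\<^sup>2 - 3 * q\<^sup>2))"
  proof -
    have "3/2 * p\<^sup>2 \<le> 4 * (p\<^sup>2 - 3 * q\<^sup>2)"
      using q5 zero_le_power2[of p] unfolding right_diff_distrib by linarith
    then have "p * (3/2 * p\<^sup>2) \<le> p * (4 * (p\<^sup>2 - 3 * q\<^sup>2))"
      using p by (rule mult_left_mono)
    then show ?thesis by (simp add: algebra_simps)
  qed
  also have "p * (p\<^sup>2 - 3 * q\<^sup>2) = Re (w * csqrt w)"
    unfolding s unfolding w by (simp add: power2_eq_square algebra_simps)
  finally show ?thesis .
qed

text \<open>The growth has order 1, below the critical order 2 of a right angle, which leaves room
  for a damping factor of the intermediate order 3/2. The damping is removed at the end by letting
  \<open>\<delta>\<close> tend to 0.\<close>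

lemma phragmen_lindelof_quadrant:
  assumes hol: "F holomorphic_on UNIV"
    and growth: "\<And>z. norm (F z) \<le> K * exp (b * norm z)"
    and re: "\<And>x. 0 \<le> x \<Longrightarrow> norm (F (of_real x)) \<le> B"
    and im: "\<And>y. 0 \<le> y \<Longrightarrow> norm (F (\<i> * of_real y)) \<le> B"
    and w: "0 \<le> Re w" "0 \<le> Im w"
  shows "norm (F w) \<le> B"
proof -
  define S where "S = {z::complex. 0 \<le> Re z \<and> 0 \<le> Im z}"
  txt \<open>Up to a positive factor, \<open>r\<close> rotates the quadrant onto the sector \<open>\<bar>arg\<bar> \<le> \<pi>/4\<close>; the translation keeps the
    corner away from the branch point of \<open>csqrt\<close>. On the sector \<open>Re (r z powr (3/2))\<close> grows
    like \<open>norm z powr (3/2)\<close>, so \<open>exp (- \<delta> * G z)\<close> beats the growth of \<open>F\<close>.\<close>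
  define r where "r z = (1 - \<i>) * (z + 1 + \<i>)" for z
  define G where "G z = r z * csqrt (r z)" for z
  have "closed S" unfolding S_def
    by (intro closed_Collect_conj closed_Collect_le continuous_intros)
  have B0: "0 \<le> B" using re[of 0] norm_ge_zero order_trans by blast
  have K0: "0 \<le> K" using order_trans[OF norm_ge_zero growth[of 0]] by simp
  have rsec: "\<bar>Im (r z)\<bar> \<le> Re (r z)" and rpos: "0 < Re (r z)" and rn: "norm z \<le> norm (r z)"
    if "z \<in> S" for z
  proof -
    show "\<bar>Im (r z)\<bar> \<le> Re (r z)" "0 < Re (r z)" using that by (auto simp: r_def S_def)
    have "norm z \<le> norm (z + 1 + \<i>)"
      using that unfolding cmod_def S_def by (intro real_sqrt_le_mono add_mono power_mono) auto
    also have "\<dots> = 1 * norm (z + 1 + \<i>)" by simp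
    also have "\<dots> \<le> norm (1 - \<i>) * norm (z + 1 + \<i>)"
      by (intro mult_right_mono) (auto simp: cmod_def)
    also have "\<dots> = norm (r z)" by (simp add: r_def norm_mult)
    finally show "norm z \<le> norm (r z)" .
  qed
  have ReG: "norm z * sqrt (norm z) / 4 \<le> Re (G z)" if "z \<in> S" for z
  proof -
    have "norm z * sqrt (norm z) \<le> norm (r z) * sqrt (norm (r z))"
      using rn[OF that] by (intro mult_mono) auto
    also have "\<dots> \<le> 4 * Re (G z)" unfolding G_def by (rule Re_mult_csqrt_ge[OF rsec[OF that]])
    finally show ?thesis by simp
  qed
  have holG: "G holomorphic_on S"
  proof -
    have "r z \<notin> \<real>\<^sub>\<le>\<^sub>0" if "z \<in> S" for z
      using rpos[OF that] by (auto simp: complex_nonpos_Reals_iff)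
    moreover have "r holomorphic_on S" unfolding r_def by (intro holomorphic_intros)
    ultimately show ?thesis unfolding G_def by (intro holomorphic_intros)
  qed
  \<comment> \<open>The damped function tends to 0 at infinity, so it eventually falls below any
    positive bound. \<open>B\<close> may be 0, whereas \<open>B'\<close> is positive.\<close>
  have *: "norm (F w * exp (- of_real \<delta> * G w)) \<le> B'" if \<delta>: "0 < \<delta>" and B': "B < B'" for \<delta> B' :: real
  proof -
    have "((\<lambda>x. K * exp (b * x - \<delta> * (x * sqrt x / 4))) \<longlongrightarrow> 0) at_top"
      using \<delta> by real_asymp
    then have "eventually (\<lambda>x. K * exp (b * x - \<delta> * (x * sqrt x / 4)) < B') at_top"
      using B0 B' by (intro order_tendstoD(2)[of _ 0]) auto
    then obtain R where R: "\<And>x. R \<le> x \<Longrightarrow> K * exp (b * x - \<delta> * (x * sqrt x / 4)) < B'"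
      by (auto simp: eventually_at_top_linorder)
    have nexp: "norm (exp (- of_real \<delta> * G z)) = exp (- \<delta> * Re (G z))" for z by simp
    show ?thesis
    proof (rule max_modulus_unbounded[of S "\<lambda>z. F z * exp (- of_real \<delta> * G z)" B' R])
      show "continuous_on S (\<lambda>z. F z * exp (- of_real \<delta> * G z))"
        using holomorphic_on_imp_continuous_on[OF holG]
          holomorphic_on_imp_continuous_on[OF holomorphic_on_subset[OF hol]]
        by (intro continuous_intros) auto
      show "(\<lambda>z. F z * exp (- of_real \<delta> * G z)) holomorphic_on interior S"
        using holomorphic_on_subset[OF holG interior_subset] holomorphic_on_subset[OF hol]
        by (intro holomorphic_intros) auto
      fix z assume "z \<in> frontier S"
      then have z: "z \<in> S" "z \<notin> interior S"
        using \<open>closed S\<close> frontier_subset_closed by (auto simp: frontier_def)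
      have "open {z::complex. 0 < Re z \<and> 0 < Im z}"
        by (intro open_Collect_conj open_Collect_less continuous_intros)
      then have "{z. 0 < Re z \<and> 0 < Im z} \<subseteq> interior S"
        by (intro interior_maximal) (auto simp: S_def)
      with z have "Im z = 0 \<and> 0 \<le> Re z \<or> Re z = 0 \<and> 0 \<le> Im z" by (force simp: S_def)
      then have "norm (F z) \<le> B"
      proof
        assume A: "Im z = 0 \<and> 0 \<le> Re z"
        then have "z = of_real (Re z)" by (simp add: complex_eq_iff)
        with re[of "Re z"] A show ?thesis by metis
      next
        assume A: "Re z = 0 \<and> 0 \<le> Im z"
        then have "z = \<i> * of_real (Im z)" by (simp add: complex_eq_iff)
        with im[of "Im z"] A show ?thesis by metis
      qed
      moreover have "0 \<le> Re (G z)" using ReG[OF z(1)] by (smt (verit) divide_nonneg_nonneg mult_nonneg_nonneg norm_ge_zero real_sqrt_ge_zero)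
      ultimately have "norm (F z) * exp (- \<delta> * Re (G z)) \<le> B * 1"
        using \<delta> B0 by (intro mult_mono) auto
      then show "norm (F z * exp (- of_real \<delta> * G z)) \<le> B'"
        using B' by (simp add: norm_mult)
    next
      fix z assume z: "z \<in> S" "R \<le> norm z"
      have "norm (F z) * exp (- \<delta> * Re (G z)) \<le>
          (K * exp (b * norm z)) * exp (- \<delta> * (norm z * sqrt (norm z) / 4))"
        using growth[of z] ReG[OF z(1)] \<delta> K0 by (intro mult_mono) auto
      also have "\<dots> = K * exp (b * norm z - \<delta> * (norm z * sqrt (norm z) / 4))"
        by (simp flip: exp_add)
      also have "\<dots> < B'" by (rule R[OF z(2)])
      finally show "norm (F z * exp (- of_real \<delta> * G z)) \<le> B'" by (simp add: norm_mult)
    qed (use \<open>closed S\<close> w in \<open>auto simp: S_def\<close>)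
  qed
  have lim: "((\<lambda>\<delta>. norm (F w * exp (- of_real \<delta> * G w))) \<longlongrightarrow> norm (F w * exp (- of_real 0 * G w))) (at_right 0)"
    by (intro tendsto_intros)
  show ?thesis
  proof (rule dense_ge)
    fix B' assume "B < B'"
    then have "eventually (\<lambda>\<delta>. norm (F w * exp (- of_real \<delta> * G w)) \<le> B') (at_right 0)"
      using * by (intro eventually_at_rightI[of 0 1]) auto
    from tendsto_upperbound[OF lim this] show "norm (F w) \<le> B'" by simp
  qed
qed

text \<open>The factor \<open>exp (i b z)\<close> has modulus 1 on the real line and cancels the
  growth along the positive imaginary axis. So \<open>H\<close> is bounded by \<open>max K M\<close>
  on both quadrants; a second damping then lowers this bound to \<open>M\<close>.\<close>

lemma phragmen_lindelof_half_plane: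
  assumes hol: "h holomorphic_on UNIV"
    and growth: "\<And>z. norm (h z) \<le> K * exp (b * norm z)"
    and re: "\<And>x. norm (h (of_real x)) \<le> M"
    and w: "0 \<le> Im w"
  shows "norm (h w) \<le> M * exp (b * Im w)"
proof -
  have K0: "0 \<le> K" using order_trans[OF norm_ge_zero growth[of 0]] by simp
  have M0: "0 \<le> M" using re[of 0] norm_ge_zero order_trans by blast
  define H where "H z = h z * exp (\<i> * of_real b * z)" for z
  have nH: "norm (H z) = norm (h z) * exp (- b * Im z)" for z by (simp add: H_def norm_mult)
  have holH: "H holomorphic_on UNIV" unfolding H_def by (intro holomorphic_intros hol)
  have growH: "norm (H z) \<le> K * exp (2 * \<bar>b\<bar> * norm z)" for z
  proof -
    have "- b * Im z \<le> \<bar>b\<bar> * norm z"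
      by (metis abs_Im_le_cmod abs_ge_self abs_ge_zero abs_minus_cancel abs_mult mult_left_mono order_trans)
    moreover have "b * norm z \<le> \<bar>b\<bar> * norm z" by (intro mult_right_mono) auto
    ultimately have "exp (b * norm z) * exp (- b * Im z) \<le> exp (2 * \<bar>b\<bar> * norm z)"
      by (simp flip: exp_add)
    then have "K * (exp (b * norm z) * exp (- b * Im z)) \<le> K * exp (2 * \<bar>b\<bar> * norm z)"
      using K0 by (rule mult_left_mono)
    moreover have "norm (H z) \<le> K * exp (b * norm z) * exp (- b * Im z)"
      unfolding nH by (intro mult_right_mono growth) auto
    ultimately show ?thesis by (simp add: mult.assoc)
  qed
  have reH: "norm (H (of_real x)) \<le> M" for x using re by (simp add: nH)
  have imH: "norm (H (\<i> * of_real y)) \<le> K" if "0 \<le> y" for y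
  proof -
    have "norm (h (\<i> * of_real y)) * exp (- b * y) \<le> K * exp (b * y) * exp (- b * y)"
      using growth[of "\<i> * of_real y"] that by (intro mult_right_mono) (auto simp: norm_mult)
    also have "\<dots> = K" by (simp add: exp_minus)
    finally show ?thesis by (simp add: nH)
  qed
  define B where "B = max K M"
  have bdd: "norm (H z) \<le> B" if z: "0 \<le> Im z" for z
  proof (cases "0 \<le> Re z")
    case True
    show ?thesis
    proof (rule phragmen_lindelof_quadrant[OF holH growH _ _ True z])
      show "norm (H (of_real x)) \<le> B" for x using reH[of x] by (simp add: B_def)
      show "norm (H (\<i> * of_real y)) \<le> B" if "0 \<le> y" for y
        using imH[OF that] by (simp add: B_def)
    qed
  next
    case False
    \<comment> \<open>The second quadrant is the first one rotated by \<open>\<i>\<close>.\<close>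
    have "norm (H (\<i> * (- \<i> * z))) \<le> B"
    proof (rule phragmen_lindelof_quadrant[of "\<lambda>z. H (\<i> * z)" K "2 * \<bar>b\<bar>"])
      show "(\<lambda>z. H (\<i> * z)) holomorphic_on UNIV"
        by (rule holomorphic_on_compose[of "\<lambda>z. \<i> * z" UNIV H, unfolded o_def])
          (auto intro!: holomorphic_intros holomorphic_on_subset[OF holH])
      show "norm (H (\<i> * z)) \<le> K * exp (2 * \<bar>b\<bar> * norm z)" for z
        using growH[of "\<i> * z"] by (simp add: norm_mult)
      show "norm (H (\<i> * of_real x)) \<le> B" if "0 \<le> x" for x
        using imH[OF that] by (simp add: B_def)
      show "norm (H (\<i> * (\<i> * of_real y))) \<le> B" for y
        using reH[of "- y"] by (simp add: B_def flip: mult.assoc)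
    qed (use False z in auto)
    then show ?thesis by (simp flip: mult.assoc)
  qed
  \<comment> \<open>The denominator has modulus at least 1 on the upper half-plane and grows
    linearly. As \<open>H\<close> is already bounded, the quotient decays at infinity, and only the
    bound on the real line survives.\<close>
  have *: "norm (H w / (1 - \<i> * of_real \<delta> * w)) \<le> M'" if \<delta>: "0 < \<delta>" and M': "M < M'" for \<delta> M'
  proof -
    have ge1: "1 \<le> norm (1 - \<i> * of_real \<delta> * z)" if "0 \<le> Im z" for z
    proof -
      have "1 \<le> Re (1 - \<i> * of_real \<delta> * z)" using that \<delta> by simp
      then show ?thesis using complex_Re_le_cmod order_trans by blast
    qed
    define S where "S = {z::complex. 0 \<le> Im z}"
    have "closed S" unfolding S_def by (intro closed_Collect_le continuous_intros)
    have nz: "1 - \<i> * of_real \<delta> * z \<noteq> 0" if "z \<in> S" for z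
      using ge1[of z] that by (auto simp: S_def)
    have hol: "(\<lambda>z. H z / (1 - \<i> * of_real \<delta> * z)) holomorphic_on S"
      using nz by (intro holomorphic_intros holomorphic_on_subset[OF holH]) auto
    show ?thesis
    \<comment> \<open>Beyond this radius the denominator has modulus at least \<open>B / M'\<close>;
      the summand 1 pays for the triangle inequality.\<close>
    proof (rule max_modulus_unbounded[of S "\<lambda>z. H z / (1 - \<i> * of_real \<delta> * z)" M' "(B / M' + 1) / \<delta>"])
      show "continuous_on S (\<lambda>z. H z / (1 - \<i> * of_real \<delta> * z))"
        by (rule holomorphic_on_imp_continuous_on[OF hol])
      show "(\<lambda>z. H z / (1 - \<i> * of_real \<delta> * z)) holomorphic_on interior S"
        by (rule holomorphic_on_subset[OF hol interior_subset])
      fix z assume "z \<in> frontier S"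
      then have z: "z \<in> S" "z \<notin> interior S"
        using \<open>closed S\<close> frontier_subset_closed by (auto simp: frontier_def)
      have "open {z::complex. 0 < Im z}" by (intro open_Collect_less continuous_intros)
      then have "{z. 0 < Im z} \<subseteq> interior S" by (intro interior_maximal) (auto simp: S_def)
      with z have "Im z = 0" by (force simp: S_def)
      then have "z = of_real (Re z)" by (simp add: complex_eq_iff)
      then have "norm (H z) \<le> M" using reH by metis
      moreover have "M' * 1 \<le> M' * norm (1 - \<i> * of_real \<delta> * z)"
        using ge1[of z] \<open>Im z = 0\<close> M0 M' by (intro mult_left_mono) auto
      ultimately show "norm (H z / (1 - \<i> * of_real \<delta> * z)) \<le> M'"
        using M' nz[OF z(1)] by (simp add: norm_divide divide_le_eq)
    next
      fix z assume z: "z \<in> S" "(B / M' + 1) / \<delta> \<le> norm z"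
      have "B / M' + 1 \<le> norm (\<i> * of_real \<delta> * z)"
        using z(2) \<delta> by (simp add: norm_mult divide_le_eq mult.commute)
      also have "\<dots> \<le> norm (1 - \<i> * of_real \<delta> * z) + 1"
        using norm_triangle_sub[of "\<i> * of_real \<delta> * z" 1] by (simp add: norm_minus_commute)
      finally have "B \<le> M' * norm (1 - \<i> * of_real \<delta> * z)"
        using M0 M' by (simp add: divide_le_eq mult.commute)
      then show "norm (H z / (1 - \<i> * of_real \<delta> * z)) \<le> M'"
        using bdd[of z] z(1) nz[OF z(1)] by (simp add: norm_divide divide_le_eq S_def)
    qed (use \<open>closed S\<close> w in \<open>auto simp: S_def\<close>)
  qed
  have lim: "((\<lambda>\<delta>. norm (H w / (1 - \<i> * of_real \<delta> * w))) \<longlongrightarrow> norm (H w / (1 - \<i> * of_real 0 * w))) (at_right 0)"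
    by (intro tendsto_intros) auto
  have "norm (H w) \<le> M"
  proof (rule dense_ge)
    fix M' assume "M < M'"
    then have "eventually (\<lambda>\<delta>. norm (H w / (1 - \<i> * of_real \<delta> * w)) \<le> M') (at_right 0)"
      using * by (intro eventually_at_rightI[of 0 1]) auto
    from tendsto_upperbound[OF lim this] show "norm (H w) \<le> M'" by simp
  qed
  then show ?thesis by (simp add: nH exp_minus field_simps)
qed

theorem phragmen_lindelof_exp_type:
  assumes hol: "h holomorphic_on UNIV"
    and growth: "\<And>z. norm (h z) \<le> K * exp (b * norm z)"
    and re: "\<And>x. norm (h (of_real x)) \<le> M"
  shows "norm (h w) \<le> M * exp (b * \<bar>Im w\<bar>)"
proof (cases "0 \<le> Im w")
  case True
  then show ?thesis using phragmen_lindelof_half_plane[OF assms] by simp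
next
  case False
  have "norm (h (- (- w))) \<le> M * exp (b * Im (- w))"
  proof (rule phragmen_lindelof_half_plane[of "\<lambda>z. h (- z)" K])
    show "(\<lambda>z. h (- z)) holomorphic_on UNIV"
      by (rule holomorphic_on_compose[of "\<lambda>z. - z" UNIV h, unfolded o_def])
        (auto intro!: holomorphic_intros holomorphic_on_subset[OF hol])
    show "norm (h (- of_real x)) \<le> M" for x using re[of "- x"] by simp
  qed (use False growth[of "- _"] in auto)
  then show ?thesis using False by simp
qed

section \<open>The Plancherel-Polya inequality\<close>

lemma pw_norm_eq: "pw_norm f = sqrt (LINT t|lborel. (norm (f (of_real t)))\<^sup>2)"
proof -
  have "f z * cnj (f z) = of_real ((norm (f z))\<^sup>2)" for z by (simp only: complex_norm_square)
  then show ?thesis unfolding pw_norm_def pw_inner_def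
    by (simp only: integral_complex_of_real Re_complex_of_real)
qed

lemma pw_norm_nonneg: "0 \<le> pw_norm f"
  unfolding pw_norm_eq by (intro real_sqrt_ge_zero integral_nonneg_AE) simp

lemma square_integral_segment_le:
  fixes f :: "complex \<Rightarrow> complex" and K b R :: real
  assumes hol: "f holomorphic_on UNIV"
    and growth: "\<And>z. norm (f z) \<le> K * exp (b * norm z)" and b: "0 \<le> b"
    and sq: "integrable lborel (\<lambda>t::real. (norm (f (of_real t)))\<^sup>2)"
    and R: "0 \<le> R"
  shows "integral {-R..R} (\<lambda>t. (norm (f (w + of_real t)))\<^sup>2)
    \<le> exp (2 * b * \<bar>Im w\<bar>) * (LINT t|lborel. (norm (f (of_real t)))\<^sup>2)"
proof -
  txt \<open>Duality: \<open>h\<close> is entire of exponential type, and \<open>h w = G\<close>. The weight \<open>l\<close> in the bound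
    \<open>(l * N + G / l) / 2\<close> of \<open>h\<close> on the real line is chosen so that Phragmen-Lindelof gives
    \<open>G \<le> (l\<^sup>2 * N + G) / 2\<close>, from which \<open>G\<close> can be absorbed.\<close>
  define g where "g t = cnj (f (w + of_real t))" for t :: real
  define h where "h z = integral (cbox (-R) R) (\<lambda>t. f (z + of_real t) * g t)" for z
  define N where "N = (LINT t|lborel. (norm (f (of_real t)))\<^sup>2)"
  define G where "G = integral {-R..R} (\<lambda>t. (norm (f (w + of_real t)))\<^sup>2)"
  define l where "l = exp (b * \<bar>Im w\<bar>)"
  have l: "0 < l" by (simp add: l_def)
  have K0: "0 \<le> K" using order_trans[OF norm_ge_zero growth[of 0]] by simp
  have contf: "continuous_on A f" for A
    using holomorphic_on_imp_continuous_on[OF hol] continuous_on_subset by blast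
  have fshift: "continuous_on A (\<lambda>t::real. f (z + of_real t))" for A z
    by (intro continuous_on_compose2[OF contf[of UNIV]] continuous_intros) auto
  have contg: "continuous_on A g" for A
    unfolding g_def by (intro continuous_intros fshift)
  have df: "(f has_field_derivative deriv f z) (at z)" for z
    using hol by (intro holomorphic_derivI[of f UNIV]) auto
  have contdf: "continuous_on UNIV (deriv f)"
    by (intro holomorphic_on_imp_continuous_on holomorphic_deriv hol) auto
  have near: "norm (f (z + of_real t)) \<le> K * exp (b * R) * exp (b * norm z)"
    if "t \<in> {-R..R}" for z t
  proof -
    have "norm (z + of_real t) \<le> norm z + R"
      using that norm_triangle_ineq[of z "of_real t"] by (auto simp: abs_le_iff)
    then have "b * norm (z + of_real t) \<le> b * R + b * norm z"
      using b mult_left_mono by (fastforce simp: algebra_simps)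
    then have "K * exp (b * norm (z + of_real t)) \<le> K * (exp (b * R) * exp (b * norm z))"
      using K0 by (intro mult_left_mono) (simp_all flip: exp_add)
    with growth[of "z + of_real t"] show ?thesis by simp
  qed
  have "h holomorphic_on UNIV"
    unfolding h_def
  proof (rule leibniz_rule_holomorphic)
    show "((\<lambda>z. f (z + of_real t) * g t) has_field_derivative deriv f (z + of_real t) * g t) (at z within UNIV)" for z t
      by (auto intro!: derivative_eq_intros DERIV_chain2[OF df])
    show "(\<lambda>t. f (z + of_real t) * g t) integrable_on cbox (-R) R" for z
      by (intro integrable_continuous continuous_intros fshift contg)
    show "continuous_on (UNIV \<times> cbox (-R) R) (\<lambda>(z, t). deriv f (z + of_real t) * g t)"
      unfolding split_beta
      by (intro continuous_intros continuous_on_compose2[OF contdf] continuous_on_compose2[OF contg[of UNIV]]) auto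
  qed auto
  \<comment> \<open>The constant depends on \<open>R\<close> and \<open>w\<close>, but
    Phragmen-Lindelof needs only its existence: the conclusion does not contain it, so the final
    estimate is uniform in \<open>R\<close>.\<close>
  moreover have "norm (h z) \<le> (K * exp (b * R) * (K * exp (b * R) * exp (b * norm w)) * (2 * R)) * exp (b * norm z)" for z
  proof -
    have "norm (f (z + of_real t) * g t)
        \<le> (K * exp (b * R) * exp (b * norm z)) * (K * exp (b * R) * exp (b * norm w))"
      if "t \<in> {-R..R}" for t
      unfolding norm_mult g_def complex_mod_cnj
      using near[OF that] K0 by (intro mult_mono) auto
    then have "norm (integral {-R..R} (\<lambda>t. f (z + of_real t) * g t))
        \<le> (K * exp (b * R) * exp (b * norm z)) * (K * exp (b * R) * exp (b * norm w)) * (R - (-R))"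
      using R by (intro integral_bound continuous_intros fshift contg) auto
    then show ?thesis by (simp add: h_def mult_ac)
  qed
  moreover have "norm (h (of_real x)) \<le> (l * N + G / l) / 2" for x
  proof -
    have int: "integrable lborel (\<lambda>t. (norm (f (of_real (x + 1 * t))))\<^sup>2)"
      by (rule lborel_integrable_real_affine[OF sq]) simp
    have eq: "(LINT t|lborel. (norm (f (of_real (x + 1 * t))))\<^sup>2) = N"
      unfolding N_def by (subst lborel_integral_real_affine[of 1 _ x]) auto
    have hk: "((\<lambda>t. (norm (f (of_real x + of_real t)))\<^sup>2) has_integral N) UNIV"
      using has_integral_integral_lborel[OF int] unfolding eq by simp
    have cont: "(\<lambda>t. (norm (f (z + of_real t)))\<^sup>2) integrable_on {-R..R}" for z
      by (intro integrable_continuous_interval continuous_intros fshift)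
    have scaled: "(\<lambda>t. k * (norm (f (z + of_real t)))\<^sup>2) integrable_on {-R..R}" for k z
      by (intro integrable_continuous_interval continuous_intros fshift)
    have "norm (h (of_real x))
        \<le> integral {-R..R} (\<lambda>t. l / 2 * (norm (f (of_real x + of_real t)))\<^sup>2 + 1 / (2 * l) * (norm (f (w + of_real t)))\<^sup>2)"
      unfolding h_def box_real
    proof (rule integral_norm_bound_integral)
      show "(\<lambda>t. f (of_real x + of_real t) * g t) integrable_on {-R..R}"
        by (intro integrable_continuous_interval continuous_intros fshift contg)
      show "(\<lambda>t. l / 2 * (norm (f (of_real x + of_real t)))\<^sup>2 + 1 / (2 * l) * (norm (f (w + of_real t)))\<^sup>2) integrable_on {-R..R}"
        by (intro integrable_continuous_interval continuous_intros fshift)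
      fix t
      define u v where "u = norm (f (of_real x + of_real t))" and "v = norm (f (w + of_real t))"
      \<comment> \<open>Weighted inequality of arithmetic and geometric means for
        \<open>u * v\<close>.\<close>
      have "0 \<le> (l * u - v)\<^sup>2 / (2 * l)" using l by simp
      also have "\<dots> = l / 2 * u\<^sup>2 + 1 / (2 * l) * v\<^sup>2 - u * v"
        using l by (simp add: power2_eq_square field_simps)
      finally show "norm (f (of_real x + of_real t) * g t) \<le> l / 2 * (norm (f (of_real x + of_real t)))\<^sup>2 + 1 / (2 * l) * (norm (f (w + of_real t)))\<^sup>2"
        by (simp add: norm_mult g_def u_def v_def)
    qed
    also have "\<dots> = l / 2 * integral {-R..R} (\<lambda>t. (norm (f (of_real x + of_real t)))\<^sup>2) + 1 / (2 * l) * G"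
      unfolding G_def
      by (subst integral_add[OF scaled scaled]) simp
    also have "integral {-R..R} (\<lambda>t. (norm (f (of_real x + of_real t)))\<^sup>2) \<le> N"
      using has_integral_subset_le[OF _ integrable_integral[OF cont] hk] by auto
    finally show ?thesis using l by (simp add: field_simps)
  qed
  ultimately have "norm (h w) \<le> (l * N + G / l) / 2 * exp (b * \<bar>Im w\<bar>)"
    by (rule phragmen_lindelof_exp_type)
  moreover have "h w = of_real G"
  proof -
    have "((\<lambda>t. (norm (f (w + of_real t)))\<^sup>2) has_integral G) {-R..R}"
      unfolding G_def by (intro integrable_integral integrable_continuous_interval continuous_intros fshift)
    then have "((\<lambda>t. of_real ((norm (f (w + of_real t)))\<^sup>2) :: complex) has_integral of_real G) {-R..R}"
      by (rule has_integral_of_real)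
    moreover have "f (w + of_real t) * g t = of_real ((norm (f (w + of_real t)))\<^sup>2)" for t
      by (simp only: g_def complex_norm_square)
    ultimately show ?thesis unfolding h_def by (simp only: box_real integral_unique)
  qed
  ultimately have "G \<le> (l * N + G / l) / 2 * l" using abs_ge_self[of G] by (simp add: l_def)
  also have "\<dots> = (l\<^sup>2 * N + G) / 2" using l by (simp add: field_simps power2_eq_square)
  finally have "G \<le> l\<^sup>2 * N" by simp
  moreover have "l\<^sup>2 = exp (2 * b * \<bar>Im w\<bar>)" by (simp add: l_def power2_eq_square flip: exp_add)
  ultimately show ?thesis by (simp add: G_def N_def)
qed

text \<open>Monotone convergence along the segments from \<open>- n\<close> to \<open>n\<close>. It
  also passes from gauge integrals over segments to the Lebesgue integral over the line.\<close>

lemma integrable_of_segment_bound: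
  fixes \<phi> :: "real \<Rightarrow> real"
  assumes cont: "continuous_on UNIV \<phi>" and nonneg: "\<And>t. 0 \<le> \<phi> t"
    and bound: "\<And>R. 0 \<le> R \<Longrightarrow> integral {-R..R} \<phi> \<le> C"
  shows "integrable lborel \<phi>" and "(LINT t|lborel. \<phi> t) \<le> C"
proof -
  have C0: "0 \<le> C" using bound[of 0] by simp
  have [measurable]: "\<phi> \<in> borel_measurable borel" using cont by (rule borel_measurable_continuous_onI)
  define u where "u n t = ennreal (\<phi> t) * indicator {- real n..real n} t" for n t
  have un: "(\<integral>\<^sup>+ t. u n t \<partial>lborel) \<le> ennreal C" for n
  proof -
    have "(\<phi> has_integral integral {- real n..real n} \<phi>) {- real n..real n}"
      by (intro integrable_integral integrable_continuous_interval continuous_on_subset[OF cont]) auto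
    then have "(\<integral>\<^sup>+ t. u n t \<partial>lborel) = ennreal (integral {- real n..real n} \<phi>)"
      unfolding u_def using nonneg by (intro nn_integral_has_integral_lebesgue') auto
    then show ?thesis using bound[of "real n"] by (simp add: ennreal_leI)
  qed
  have sup: "ennreal (\<phi> t) = (SUP n. u n t)" for t
  proof (rule antisym)
    obtain n where "\<bar>t\<bar> \<le> real n" using real_arch_simple by blast
    then have "ennreal (\<phi> t) = u n t" by (auto simp: u_def abs_le_iff)
    also have "\<dots> \<le> (SUP n. u n t)" by (rule SUP_upper) simp
    finally show "ennreal (\<phi> t) \<le> (SUP n. u n t)" .
    show "(SUP n. u n t) \<le> ennreal (\<phi> t)" by (rule SUP_least) (auto simp: u_def indicator_def)
  qed
  have le: "(\<integral>\<^sup>+ t. ennreal (\<phi> t) \<partial>lborel) \<le> ennreal C"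
    unfolding sup
  proof (subst nn_integral_monotone_convergence_SUP)
    show "incseq u" by (auto simp: u_def incseq_def le_fun_def indicator_def)
    show "u n \<in> borel_measurable lborel" for n unfolding u_def by measurable
    show "(SUP n. \<integral>\<^sup>+ t. u n t \<partial>lborel) \<le> ennreal C" using un by (intro SUP_least)
  qed
  show int: "integrable lborel \<phi>"
    using le nonneg by (intro integrableI_bounded) (auto simp: order_le_less_trans)
  show "(LINT t|lborel. \<phi> t) \<le> C"
    using le nn_integral_eq_integral[OF int] nonneg C0 by simp
qed

text \<open>As \<open>norm (c * z + d)\<close> is at most \<open>norm z + norm d\<close>, only the
  constant changes.\<close>

lemma exp_type_le_affine:
  assumes f: "exp_type_le a f" and a: "0 \<le> a" and c: "norm c \<le> 1"
  shows "exp_type_le a (\<lambda>z. f (c * z + d))"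
  unfolding exp_type_le_def
proof (intro allI impI)
  fix \<epsilon> :: real assume e: "0 < \<epsilon>"
  then obtain K where K: "\<And>z. norm (f z) \<le> K * exp ((a + \<epsilon>) * norm z)"
    using f unfolding exp_type_le_def by blast
  have K0: "0 \<le> K" using order_trans[OF norm_ge_zero K[of 0]] by simp
  have "norm (f (c * z + d)) \<le> (K * exp ((a + \<epsilon>) * norm d)) * exp ((a + \<epsilon>) * norm z)" for z
  proof -
    have "norm c * norm z \<le> norm z" using c by (simp add: mult_left_le_one_le)
    then have "norm (c * z + d) \<le> norm d + norm z"
      using norm_triangle_ineq[of "c * z" d] by (simp add: norm_mult)
    then have "(a + \<epsilon>) * norm (c * z + d) \<le> (a + \<epsilon>) * (norm d + norm z)"
      using a e by (intro mult_left_mono) auto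
    then have "exp ((a + \<epsilon>) * norm (c * z + d)) \<le> exp ((a + \<epsilon>) * norm d) * exp ((a + \<epsilon>) * norm z)"
      by (simp add: ring_distribs flip: exp_add)
    then have "K * exp ((a + \<epsilon>) * norm (c * z + d)) \<le> K * (exp ((a + \<epsilon>) * norm d) * exp ((a + \<epsilon>) * norm z))"
      using K0 by (rule mult_left_mono)
    with K[of "c * z + d"] show ?thesis by simp
  qed
  then show "\<exists>K. \<forall>z. norm (f (c * z + d)) \<le> K * exp ((a + \<epsilon>) * norm z)" by blast
qed

text \<open>The segment bound, uniform in \<open>R\<close>, extends to the whole line, and a real
  substitution with \<open>\<bar>c\<bar> = 1\<close> preserves the integral. The exponent
  \<open>a + 1\<close> comes from taking \<epsilon> = 1 in \<open>exp_type_le\<close>; a fixed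
  constant is enough for power boundedness.\<close>

theorem plancherel_polya:
  fixes a c :: real
  assumes f: "f \<in> paley_wiener a" and a: "0 \<le> a" and c: "\<bar>c\<bar> = 1"
  shows "(\<lambda>z. f (of_real c * z + d)) \<in> paley_wiener a"
    and "pw_norm (\<lambda>z. f (of_real c * z + d)) \<le> exp ((a + 1) * \<bar>Im d\<bar>) * pw_norm f"
proof -
  have hol: "f holomorphic_on UNIV" and type: "exp_type_le a f"
    and sq: "integrable lborel (\<lambda>t::real. (norm (f (of_real t)))\<^sup>2)"
    using f by (auto simp: paley_wiener_def)
  obtain K where K: "\<And>z. norm (f z) \<le> K * exp ((a + 1) * norm z)"
    using type unfolding exp_type_le_def by (metis zero_less_one)
  have comp: "(\<lambda>z. f (of_real c * z + d)) holomorphic_on UNIV"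
    by (rule holomorphic_on_compose[of "\<lambda>z. of_real c * z + d" UNIV f, unfolded o_def])
      (auto intro!: holomorphic_intros holomorphic_on_subset[OF hol])
  have cont: "continuous_on UNIV (\<lambda>t::real. (norm (f (d + of_real t)))\<^sup>2)"
    by (intro continuous_intros continuous_on_compose2[OF holomorphic_on_imp_continuous_on[OF hol]]) auto
  have seg: "integral {-R..R} (\<lambda>t. (norm (f (d + of_real t)))\<^sup>2)
      \<le> exp (2 * (a + 1) * \<bar>Im d\<bar>) * (LINT t|lborel. (norm (f (of_real t)))\<^sup>2)" if "0 \<le> R" for R
    using square_integral_segment_le[OF hol K _ sq that] a by auto
  note I = integrable_of_segment_bound[OF cont zero_le_power2 seg]
  have "integrable lborel (\<lambda>t. (norm (f (d + of_real (0 + c * t))))\<^sup>2)"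
    using c by (intro lborel_integrable_real_affine[OF I(1)]) auto
  then have int: "integrable lborel (\<lambda>t. (norm (f (of_real c * of_real t + d)))\<^sup>2)"
    by (simp add: add.commute)
  then show "(\<lambda>z. f (of_real c * z + d)) \<in> paley_wiener a"
    using comp exp_type_le_affine[OF type a, of "of_real c" d] c by (simp add: paley_wiener_def)
  have "(LINT t|lborel. (norm (f (d + of_real t)))\<^sup>2) = (LINT t|lborel. (norm (f (d + of_real (0 + c * t))))\<^sup>2)"
    using c by (subst lborel_integral_real_affine[of c _ 0]) auto
  then have "(LINT t|lborel. (norm (f (of_real c * of_real t + d)))\<^sup>2)
      \<le> exp (2 * (a + 1) * \<bar>Im d\<bar>) * (LINT t|lborel. (norm (f (of_real t)))\<^sup>2)"
    using I(2) by (simp add: add.commute)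
  also have "exp (2 * (a + 1) * \<bar>Im d\<bar>) = (exp ((a + 1) * \<bar>Im d\<bar>))\<^sup>2"
    by (simp add: power2_eq_square algebra_simps flip: exp_add)
  finally show "pw_norm (\<lambda>z. f (of_real c * z + d)) \<le> exp ((a + 1) * \<bar>Im d\<bar>) * pw_norm f"
    unfolding pw_norm_eq using real_sqrt_le_mono by (fastforce simp: real_sqrt_mult)
qed

section \<open>Composition operators\<close>

lemma composition_op_funpow: "(composition_op \<phi> ^^ n) f = f \<circ> (\<phi> ^^ n)"
  by (induction n) (auto simp: composition_op_def fun_eq_iff funpow_swap1)

lemma affine_funpow:
  fixes c d z :: "'a::comm_ring_1"
  shows "((\<lambda>z. c * z + d) ^^ n) z = c ^ n * z + d * (\<Sum>i<n. c ^ i)"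
proof (induction n)
  case (Suc n)
  have "d * (\<Sum>i<Suc n. c ^ i) = d * (1 + c * (\<Sum>i<n. c ^ i))"
    by (simp add: sum.lessThan_Suc_shift sum_distrib_left del: sum.lessThan_Suc)
  then show ?case using Suc by (simp add: algebra_simps del: sum.lessThan_Suc)
qed simp

lemma composition_affine_funpow:
  fixes c :: real and d :: complex
  shows "(composition_op (\<lambda>z. of_real c * z + d) ^^ n) f
    = (\<lambda>z. f (of_real (c ^ n) * z + d * of_real (\<Sum>i<n. c ^ i)))"
  unfolding composition_op_funpow by (simp add: fun_eq_iff affine_funpow)

section \<open>The test function \<open>sin (a z) / z\<close> and lower bounds for its norm under
  affine substitutions\<close>

definition pw_test :: "real \<Rightarrow> complex \<Rightarrow> complex" where
  "pw_test a z = (if z = 0 then deriv (\<lambda>z. sin (of_real a * z)) 0 else sin (of_real a * z) / z)"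

lemma norm_sin_le:
  fixes z :: complex
  shows "norm (sin z) \<le> exp \<bar>Im z\<bar>"
proof -
  have "norm (sin z) = norm (exp (\<i> * z) - exp (- (\<i> * z))) / 2"
    by (simp add: sin_exp_eq norm_divide norm_mult)
  also have "\<dots> \<le> (norm (exp (\<i> * z)) + norm (exp (- (\<i> * z)))) / 2"
    by (intro divide_right_mono norm_triangle_ineq4) auto
  also have "\<dots> = (exp (- Im z) + exp (Im z)) / 2" by simp
  also have "\<dots> \<le> (exp \<bar>Im z\<bar> + exp \<bar>Im z\<bar>) / 2"
    by (intro divide_right_mono add_mono) auto
  finally show ?thesis by simp
qed

lemma holomorphic_pw_test: "pw_test a holomorphic_on UNIV"
proof -
  \<comment> \<open>This is the difference quotient of \<open>sin (a z)\<close> at 0, continued by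
    the derivative: the shape that \<open>pole_lemma\<close> handles, and the reason for
    \<open>deriv\<close> in the definition of \<open>pw_test\<close>.\<close>
  have "(\<lambda>z. if z = 0 then deriv (\<lambda>z. sin (of_real a * z)) 0
      else (sin (of_real a * z) - sin (of_real a * 0)) / (z - 0)) holomorphic_on UNIV"
    by (rule pole_lemma) (auto intro!: holomorphic_intros)
  then show ?thesis by (simp add: pw_test_def[abs_def] cong: if_cong)
qed

text \<open>Compactness controls the unit disc, division by \<open>z\<close> the rest. The first
  bound yields the exponential type, the second the decay needed for square integrability.\<close>

lemma norm_pw_test_le:
  obtains K where "0 \<le> K" and "\<And>z. norm (pw_test a z) \<le> K * exp (\<bar>a\<bar> * \<bar>Im z\<bar>)"
    and "\<And>z. 1 \<le> norm z \<Longrightarrow> norm (pw_test a z) \<le> exp (\<bar>a\<bar> * \<bar>Im z\<bar>) / norm z"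
proof -
  have "compact (pw_test a ` cball 0 1)"
    using holomorphic_on_imp_continuous_on[OF holomorphic_pw_test]
    by (intro compact_continuous_image) (auto intro: continuous_on_subset)
  then obtain B where B: "\<And>z. z \<in> cball 0 1 \<Longrightarrow> norm (pw_test a z) \<le> B"
    using compact_imp_bounded by (metis bounded_iff imageI)
  have far: "norm (pw_test a z) \<le> exp (\<bar>a\<bar> * \<bar>Im z\<bar>) / norm z" if "1 \<le> norm z" for z
    using norm_sin_le[of "of_real a * z"] that
    by (auto simp: pw_test_def norm_divide abs_mult intro!: divide_right_mono)
  have "norm (pw_test a z) \<le> max 1 B * exp (\<bar>a\<bar> * \<bar>Im z\<bar>)" for z
  proof (cases "norm z \<le> 1")
    case True
    then have "norm (pw_test a z) \<le> max 1 B * 1" using B[of z] by simp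
    also have "\<dots> \<le> max 1 B * exp (\<bar>a\<bar> * \<bar>Im z\<bar>)" by (intro mult_left_mono) auto
    finally show ?thesis .
  next
    case False
    then have "exp (\<bar>a\<bar> * \<bar>Im z\<bar>) / norm z \<le> exp (\<bar>a\<bar> * \<bar>Im z\<bar>) * 1"
      by (simp add: divide_le_eq mult_left_le)
    also have "\<dots> \<le> exp (\<bar>a\<bar> * \<bar>Im z\<bar>) * max 1 B" by (intro mult_left_mono) auto
    finally show ?thesis using far[of z] False by (simp add: mult.commute)
  qed
  with far show ?thesis by (intro that[of "max 1 B"]) auto
qed

lemma pw_test_in_paley_wiener:
  assumes "0 \<le> a"
  shows "pw_test a \<in> paley_wiener a"
  unfolding paley_wiener_def
proof (intro CollectI conjI holomorphic_pw_test)
  obtain K where K0: "0 \<le> K" and K: "\<And>z. norm (pw_test a z) \<le> K * exp (\<bar>a\<bar> * \<bar>Im z\<bar>)"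
    and far: "\<And>z. 1 \<le> norm z \<Longrightarrow> norm (pw_test a z) \<le> exp (\<bar>a\<bar> * \<bar>Im z\<bar>) / norm z"
    using norm_pw_test_le[of a] by blast
  show "exp_type_le a (pw_test a)"
    unfolding exp_type_le_def
  proof (intro allI impI exI[of _ K])
    fix \<epsilon> :: real and z assume "0 < \<epsilon>"
    then have "\<bar>a\<bar> * \<bar>Im z\<bar> \<le> (a + \<epsilon>) * norm z"
      using assms by (intro mult_mono abs_Im_le_cmod) auto
    then have "K * exp (\<bar>a\<bar> * \<bar>Im z\<bar>) \<le> K * exp ((a + \<epsilon>) * norm z)"
      using K0 by (intro mult_left_mono) auto
    with K[of z] show "norm (pw_test a z) \<le> K * exp ((a + \<epsilon>) * norm z)" by simp
  qed
  have cont: "continuous_on UNIV (\<lambda>t::real. (norm (pw_test a (of_real t)))\<^sup>2)"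
    by (intro continuous_intros continuous_on_compose2[OF holomorphic_on_imp_continuous_on[OF holomorphic_pw_test]]) auto
  \<comment> \<open>The factor 2 bounds \<open>1 + t\<^sup>2\<close> for
    \<open>\<bar>t\<bar> \<le> 1\<close> and \<open>(1 + t\<^sup>2) / t\<^sup>2\<close>
    elsewhere.\<close>
  define L where "L = 2 * max 1 (K\<^sup>2)"
  have L0: "0 \<le> L" by (simp add: L_def)
  have bound: "(norm (pw_test a (of_real t)))\<^sup>2 \<le> L * inverse (1 + t\<^sup>2)" for t :: real
  proof (cases "\<bar>t\<bar> \<le> 1")
    case True
    then have "t\<^sup>2 \<le> 1" by (simp add: abs_square_le_1)
    have "(norm (pw_test a (of_real t)))\<^sup>2 \<le> K\<^sup>2"
      using K[of "of_real t"] by (intro power_mono) auto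
    then have "(norm (pw_test a (of_real t)))\<^sup>2 * (1 + t\<^sup>2) \<le> K\<^sup>2 * 2"
      using \<open>t\<^sup>2 \<le> 1\<close> by (intro mult_mono) auto
    also have "\<dots> \<le> L" by (simp add: L_def)
    finally show ?thesis by (simp add: field_simps add_pos_nonneg)
  next
    case False
    then have "1 \<le> t\<^sup>2" using abs_square_le_1[of t] by linarith
    have "(norm (pw_test a (of_real t)))\<^sup>2 \<le> (1 / \<bar>t\<bar>)\<^sup>2"
      using far[of "of_real t"] False by (intro power_mono) auto
    then have "(norm (pw_test a (of_real t)))\<^sup>2 * (1 + t\<^sup>2) \<le> (1 / \<bar>t\<bar>)\<^sup>2 * (1 + t\<^sup>2)"
      by (intro mult_right_mono) auto
    also have "\<dots> = (1 + t\<^sup>2) / t\<^sup>2" by (simp add: power_divide)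
    also have "\<dots> \<le> 2" using \<open>1 \<le> t\<^sup>2\<close> by (simp add: divide_le_eq)
    also have "\<dots> \<le> L" by (simp add: L_def)
    finally show ?thesis by (simp add: field_simps add_pos_nonneg)
  qed
  show "integrable lborel (\<lambda>t::real. (norm (pw_test a (of_real t)))\<^sup>2)"
  proof (rule Bochner_Integration.integrable_bound)
    show "integrable lborel (\<lambda>t::real. L * inverse (1 + t\<^sup>2))"
      using integrable_inverse_1_plus_square by (simp add: set_integrable_def)
    show "(\<lambda>t::real. (norm (pw_test a (of_real t)))\<^sup>2) \<in> borel_measurable lborel"
      using borel_measurable_continuous_onI[OF cont] by simp
    show "AE t in lborel. norm ((norm (pw_test a (of_real t)))\<^sup>2) \<le> norm (L * inverse (1 + t\<^sup>2))"
      using bound L0 by (auto simp: add_nonneg_nonneg)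
  qed
qed

lemma norm_sin_square_ge:
  fixes z :: complex
  assumes "pi / 4 \<le> Re z" and "Re z \<le> pi / 2"
  shows "exp (2 * \<bar>Im z\<bar>) / 4 \<le> (norm (sin z))\<^sup>2"
proof -
  have "cos (2 * Re z) \<le> 0"
    using cos_monotone_0_pi_le[of "pi/2" "2 * Re z"] assms pi_gt_zero by (simp add: field_simps)
  moreover have "exp (2 * \<bar>Im z\<bar>) \<le> exp (2 * Im z) + inverse (exp (2 * Im z))"
    by (cases "0 \<le> Im z") (auto simp: exp_minus[symmetric])
  ultimately show ?thesis unfolding norm_sin_squared by simp
qed

text \<open>Substituting \<open>s = Re d + c * t\<close> turns the integral into one over the
  horizontal line at height \<open>Im d\<close>, at the price of \<open>1 / \<bar>c\<bar>\<close>.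
  Only the part with \<open>a * s\<close> between pi/4 and pi/2 is kept, where the sine is large.
  Membership \<open>mem\<close> supplies the integrability that the comparison requires.\<close>

lemma pw_norm_pw_test_ge:
  fixes a c :: real
  assumes a: "0 < a" and c: "c \<noteq> 0"
    and mem: "(\<lambda>z. pw_test a (of_real c * z + d)) \<in> paley_wiener a"
  shows "pi / (16 * a) * exp (2 * a * \<bar>Im d\<bar>) / (\<bar>c\<bar> * ((pi / (2 * a))\<^sup>2 + (Im d)\<^sup>2))
    \<le> (pw_norm (\<lambda>z. pw_test a (of_real c * z + d)))\<^sup>2"
proof -
  define p q where "p = pi / (4 * a)" and "q = pi / (2 * a)"
  define m where "m = exp (2 * a * \<bar>Im d\<bar>) / (4 * (q\<^sup>2 + (Im d)\<^sup>2))"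
  define F where "F s = (norm (pw_test a (Complex s (Im d))))\<^sup>2" for s
  have pq: "0 < p" "p \<le> q" "q - p = pi / (4 * a)"
    using a by (auto simp: p_def q_def field_simps)
  have q0: "0 < q" using pq by simp
  have m0: "0 \<le> m" by (simp add: m_def)
  have shift: "of_real c * of_real t + d = Complex (Re d + c * t) (Im d)" for t
    by (simp add: complex_eq_iff)
  have int: "integrable lborel (\<lambda>t. F (Re d + c * t))"
    using mem by (simp add: paley_wiener_def F_def shift)
  then have intF: "integrable lborel F"
    using c by (simp add: lborel_integrable_real_affine_iff)
  have low: "m \<le> F s" if s: "s \<in> {p..q}" for s
  proof -
    let ?z = "Complex s (Im d)"
    have nz: "?z \<noteq> 0" using s pq by (auto simp: complex_eq_iff)
    have "pi / 4 \<le> a * s" "a * s \<le> pi / 2"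
      using s a by (auto simp: p_def q_def field_simps)
    then have 1: "exp (2 * a * \<bar>Im d\<bar>) / 4 \<le> (norm (sin (of_real a * ?z)))\<^sup>2"
      using norm_sin_square_ge[of "of_real a * ?z"] a by (simp add: abs_mult mult.assoc)
    have 2: "(norm ?z)\<^sup>2 \<le> q\<^sup>2 + (Im d)\<^sup>2"
      using s pq by (auto simp: cmod_power2 intro!: power_mono)
    have "m = exp (2 * a * \<bar>Im d\<bar>) / 4 / (q\<^sup>2 + (Im d)\<^sup>2)" by (simp add: m_def)
    also have "\<dots> \<le> (norm (sin (of_real a * ?z)))\<^sup>2 / (norm ?z)\<^sup>2"
      using 1 2 nz by (intro frac_le) auto
    also have "\<dots> = F s" using nz by (simp add: F_def pw_test_def norm_divide power_divide)
    finally show ?thesis .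
  qed
  have "(q - p) * m = (LINT s|lborel. m * indicator {p..q} s)"
    using pq by simp
  also have "\<dots> \<le> (LINT s|lborel. F s)"
  proof (rule integral_mono[OF _ intF])
    show "integrable lborel (\<lambda>s. m * indicator {p..q} s)"
      by (intro integrable_mult_right integrable_real_indicator) (auto simp: emeasure_lborel_Icc_eq)
    show "m * indicator {p..q} s \<le> F s" for s
      using low[of s] by (auto simp: indicator_def F_def)
  qed
  also have "\<dots> = \<bar>c\<bar> * (LINT t|lborel. F (Re d + c * t))"
    using c by (subst lborel_integral_real_affine[of c _ "Re d"]) auto
  also have "(LINT t|lborel. F (Re d + c * t)) = (pw_norm (\<lambda>z. pw_test a (of_real c * z + d)))\<^sup>2"
    unfolding pw_norm_eq shift F_def by (subst real_sqrt_pow2) (auto intro: integral_nonneg_AE)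
  finally have "(q - p) * m / \<bar>c\<bar> \<le> (pw_norm (\<lambda>z. pw_test a (of_real c * z + d)))\<^sup>2"
    using c by (simp add: divide_le_eq mult.commute)
  moreover have "(q - p) * m / \<bar>c\<bar> = pi / (16 * a) * exp (2 * a * \<bar>Im d\<bar>) / (\<bar>c\<bar> * (q\<^sup>2 + (Im d)\<^sup>2))"
    unfolding pq m_def by simp
  ultimately show ?thesis by (simp add: q_def)
qed

section \<open>Absolute Cesaro boundedness and the growth of powers of an operator\<close>

lemma bounded_linear_op_on_composition_op:
  assumes "\<And>f. f \<in> E \<Longrightarrow> composition_op \<phi> f \<in> E"
    and "\<And>f. f \<in> E \<Longrightarrow> N (composition_op \<phi> f) \<le> K * N f"
  shows "bounded_linear_op_on E N (composition_op \<phi>)"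
  using assms unfolding bounded_linear_op_on_def by (auto simp: composition_op_def fun_eq_iff)

lemma absolutely_cesaro_bounded_if_power_bounded:
  assumes lin: "bounded_linear_op_on E N T" and K: "0 < K"
    and pow: "\<And>f j. f \<in> E \<Longrightarrow> N ((T ^^ j) f) \<le> K * N f"
  shows "absolutely_cesaro_bounded E N T"
  unfolding absolutely_cesaro_bounded_def
proof (intro conjI lin exI[of _ K] K ballI SUP_least)
  fix f and n :: nat assume f: "f \<in> E" and n: "n \<in> {1..}"
  have "(\<Sum>j=1..n. N ((T ^^ j) f)) \<le> (\<Sum>j=1..n. K * N f)"
    by (intro sum_mono pow f)
  then show "ereal (1 / real n * (\<Sum>j=1..n. N ((T ^^ j) f))) \<le> ereal (K * N f)"
    using n by (simp add: field_simps)
qed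

text \<open>The last summand is at most the whole sum, which is \<open>n\<close> times a bounded
  average. Linear growth is enough to contradict exponential growth.\<close>

lemma absolutely_cesaro_bounded_power_le:
  assumes acb: "absolutely_cesaro_bounded E N T" and nonneg: "\<And>f. 0 \<le> N f" and f: "f \<in> E"
  obtains C where "\<And>n. 1 \<le> n \<Longrightarrow> N ((T ^^ n) f) \<le> C * real n"
proof -
  obtain C where "(SUP n\<in>{1::nat..}. ereal (1 / real n * (\<Sum>j=1..n. N ((T ^^ j) f)))) \<le> ereal (C * N f)"
    using acb f unfolding absolutely_cesaro_bounded_def by blast
  then have C: "1 / real n * (\<Sum>j=1..n. N ((T ^^ j) f)) \<le> C * N f" if "1 \<le> n" for n
    using that by (auto simp: SUP_le_iff)
  have "N ((T ^^ n) f) \<le> C * N f * real n" if n: "1 \<le> n" for n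
  proof -
    have "N ((T ^^ n) f) \<le> (\<Sum>j=1..n. N ((T ^^ j) f))"
      using n nonneg by (intro member_le_sum) auto
    also have "\<dots> \<le> C * N f * real n" using C[OF n] n by (simp add: field_simps)
    finally show ?thesis .
  qed
  then show ?thesis by (rule that)
qed

lemma bounded_linear_op_on_funpow:
  assumes "bounded_linear_op_on E N T" and "f \<in> E"
  shows "(T ^^ n) f \<in> E"
  using assms by (induction n) (auto simp: bounded_linear_op_on_def)

theorem theorem4p7:
  fixes a c :: real and d :: complex
  assumes "0 < a" and "0 < \<bar>c\<bar>" and "\<bar>c\<bar> \<le> 1"
  shows "absolutely_cesaro_bounded (paley_wiener a) pw_norm
           (composition_op (\<lambda>z. complex_of_real c * z + d))
         \<longleftrightarrow> c = -1 \<or> (c = 1 \<and> d \<in> \<real>)"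
proof
  define T where "T = composition_op (\<lambda>z. complex_of_real c * z + d)"
  \<comment> \<open>The imaginary part of the translation in the \<open>n\<close>-th power; the
    estimates depend on the translation only through it.\<close>
  define y where "y n = Im d * (\<Sum>i<n. c ^ i)" for n
  have Tn: "(T ^^ n) f = (\<lambda>z. f (of_real (c ^ n) * z + d * of_real (\<Sum>i<n. c ^ i)))" for n f
    unfolding T_def by (rule composition_affine_funpow)
  have Im_y: "Im (d * of_real (\<Sum>i<n. c ^ i)) = y n" for n
    by (simp only: y_def Im_complex_of_real Re_complex_of_real times_complex.sel mult_zero_right add_0)
  {
    assume "absolutely_cesaro_bounded (paley_wiener a) pw_norm
      (composition_op (\<lambda>z. complex_of_real c * z + d))"
    then have acb: "absolutely_cesaro_bounded (paley_wiener a) pw_norm T" by (simp add: T_def)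
    have mem: "pw_test a \<in> paley_wiener a" using assms by (intro pw_test_in_paley_wiener) auto
    have memn: "(T ^^ n) (pw_test a) \<in> paley_wiener a" for n
      using acb mem by (auto simp: absolutely_cesaro_bounded_def intro: bounded_linear_op_on_funpow)
    obtain C where C: "\<And>n. 1 \<le> n \<Longrightarrow> pw_norm ((T ^^ n) (pw_test a)) \<le> C * real n"
      using absolutely_cesaro_bounded_power_le[OF acb pw_norm_nonneg mem] by blast
    \<comment> \<open>The lower bound for the test function against the square of the linear upper
      bound; both cases below contradict this for large \<open>n\<close>.\<close>
    have key: "pi / (16 * a) * exp (2 * a * \<bar>y n\<bar>) / (\<bar>c\<bar> ^ n * ((pi / (2 * a))\<^sup>2 + (y n)\<^sup>2))
        \<le> C\<^sup>2 * (real n)\<^sup>2" if "1 \<le> n" for n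
    proof -
      have "(pw_norm ((T ^^ n) (pw_test a)))\<^sup>2 \<le> (C * real n)\<^sup>2"
        by (intro power_mono C that pw_norm_nonneg)
      moreover have "pi / (16 * a) * exp (2 * a * \<bar>y n\<bar>) / (\<bar>c ^ n\<bar> * ((pi / (2 * a))\<^sup>2 + (y n)\<^sup>2))
          \<le> (pw_norm ((T ^^ n) (pw_test a)))\<^sup>2"
        using pw_norm_pw_test_ge[of a "c ^ n" "d * of_real (\<Sum>i<n. c ^ i)", folded Tn, OF _ _ memn] assms
        unfolding Im_y by auto
      ultimately show ?thesis by (simp add: power_abs power_mult_distrib)
    qed
    show "c = -1 \<or> (c = 1 \<and> d \<in> \<real>)"
    proof (rule ccontr)
      assume not: "\<not> (c = -1 \<or> (c = 1 \<and> d \<in> \<real>))"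
      have "\<bar>c\<bar> < 1 \<or> c = 1 \<or> c = -1" using assms(3) by linarith
      with not consider "\<bar>c\<bar> < 1" | "c = 1" "Im d \<noteq> 0"
        by (auto simp: complex_is_Real_iff)
      then show False
      proof cases
        case 1
        \<comment> \<open>\<open>Y\<close> bounds every \<open>\<bar>y n\<bar>\<close> by the
          geometric series. \<open>e\<close> is what remains of the lower bound in
          \<open>key\<close> apart from \<open>\<bar>c\<bar> ^ n\<close>, once the exponential is
          estimated below by 1.\<close>
        define Y where "Y = \<bar>Im d\<bar> * (1 / (1 - \<bar>c\<bar>))"
        define e where "e = pi / (16 * a) / ((pi / (2 * a))\<^sup>2 + Y\<^sup>2)"
        have e: "0 < e" unfolding e_def using assms by (intro divide_pos_pos add_pos_nonneg) auto
        have Y: "\<bar>y n\<bar> \<le> Y" for n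
        proof -
          have "\<bar>\<Sum>i<n. c ^ i\<bar> \<le> (\<Sum>i<n. \<bar>c\<bar> ^ i)"
            using sum_abs[of "\<lambda>i. c ^ i" "{..<n}"] by (simp add: power_abs)
          also have "\<dots> \<le> (\<Sum>i. \<bar>c\<bar> ^ i)"
            using 1 by (intro sum_le_suminf summable_geometric) auto
          also have "\<dots> = 1 / (1 - \<bar>c\<bar>)" using 1 by (simp add: suminf_geometric)
          finally show ?thesis unfolding y_def Y_def abs_mult by (intro mult_left_mono) auto
        qed
        have le: "e * (1 / \<bar>c\<bar>) ^ n \<le> C\<^sup>2 * (real n)\<^sup>2" if "1 \<le> n" for n
        proof -
          have "(y n)\<^sup>2 \<le> Y\<^sup>2" using Y[of n] by (metis abs_ge_zero power2_abs power_mono)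
          have "e * (1 / \<bar>c\<bar>) ^ n = pi / (16 * a) * 1 / (\<bar>c\<bar> ^ n * ((pi / (2 * a))\<^sup>2 + Y\<^sup>2))"
            by (simp add: e_def power_divide)
          also have "\<dots> \<le> pi / (16 * a) * exp (2 * a * \<bar>y n\<bar>) / (\<bar>c\<bar> ^ n * ((pi / (2 * a))\<^sup>2 + (y n)\<^sup>2))"
            using assms \<open>(y n)\<^sup>2 \<le> Y\<^sup>2\<close>
            by (intro frac_le mult_left_mono mult_pos_pos add_left_mono add_pos_nonneg) auto
          also note key[OF that]
          finally show ?thesis .
        qed
        have gt: "eventually (\<lambda>n. e * (1 / \<bar>c\<bar>) ^ n > C\<^sup>2 * (real n)\<^sup>2) sequentially"
        proof -
          define r where "r = \<bar>c\<bar>"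
          have "0 < r" "r < 1" using assms 1 by (auto simp: r_def)
          then show ?thesis using e unfolding r_def[symmetric] by real_asymp
        qed
        from gt eventually_ge_at_top[of 1] have "eventually (\<lambda>n::nat. False) sequentially"
          by eventually_elim (meson le not_le)
        then show False by simp
      next
        case 2
        define k where "k = \<bar>Im d\<bar>"
        have k: "0 < k" using 2 by (simp add: k_def)
        have yn: "\<bar>y n\<bar> = k * real n" for n by (simp add: y_def k_def 2 abs_mult)
        have le: "pi / (16 * a) * exp (2 * a * (k * real n)) / ((pi / (2 * a))\<^sup>2 + (k * real n)\<^sup>2) \<le> C\<^sup>2 * (real n)\<^sup>2" if "1 \<le> n" for n
          using key[OF that] unfolding yn[symmetric] by (simp add: 2)
        have gt: "eventually (\<lambda>n. pi / (16 * a) * exp (2 * a * (k * real n)) / ((pi / (2 * a))\<^sup>2 + (k * real n)\<^sup>2) > C\<^sup>2 * (real n)\<^sup>2) sequentially"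
          using assms(1) k by real_asymp
        from gt eventually_ge_at_top[of 1] have "eventually (\<lambda>n::nat. False) sequentially"
          by eventually_elim (meson le not_le)
        then show False by simp
      qed
    qed
  }
  assume cd: "c = -1 \<or> (c = 1 \<and> d \<in> \<real>)"
  then have c1: "\<bar>c\<bar> = 1" by auto
  have y: "\<bar>y n\<bar> \<le> \<bar>Im d\<bar>" for n
  proof (cases "c = -1")
    case True
    \<comment> \<open>The map \<open>z \<mapsto> - z + d\<close> is an involution, so its powers
      translate by 0 or \<open>d\<close> only.\<close>
    have "(\<Sum>i<n. (-1::real) ^ i) = (if even n then 0 else 1)" by (induction n) auto
    with True show ?thesis by (simp add: y_def)
  next
    case False
    with cd show ?thesis by (simp add: y_def complex_is_Real_iff)
  qed
  define K where "K = exp ((a + 1) * \<bar>Im d\<bar>)"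
  have pow: "pw_norm ((T ^^ n) f) \<le> K * pw_norm f" if f: "f \<in> paley_wiener a" for n f
  proof -
    have "pw_norm ((T ^^ n) f) \<le> exp ((a + 1) * \<bar>y n\<bar>) * pw_norm f"
      unfolding Tn Im_y[symmetric]
      using assms c1 by (intro plancherel_polya(2)[OF f]) (auto simp: power_abs)
    also have "\<dots> \<le> K * pw_norm f"
      unfolding K_def using assms y[of n] by (intro mult_right_mono pw_norm_nonneg) auto
    finally show ?thesis .
  qed
  have "absolutely_cesaro_bounded (paley_wiener a) pw_norm T"
  proof (rule absolutely_cesaro_bounded_if_power_bounded[OF _ _ pow])
    show "bounded_linear_op_on (paley_wiener a) pw_norm T"
      unfolding T_def
    proof (rule bounded_linear_op_on_composition_op)
      fix f assume f: "f \<in> paley_wiener a"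
      show "composition_op (\<lambda>z. of_real c * z + d) f \<in> paley_wiener a"
        using plancherel_polya(1)[OF f _ c1, of d] assms by (simp add: composition_op_def o_def)
      show "pw_norm (composition_op (\<lambda>z. of_real c * z + d) f) \<le> K * pw_norm f"
        using pow[OF f, of 1] by (simp add: T_def)
    qed
  qed (simp add: K_def)
  then show "absolutely_cesaro_bounded (paley_wiener a) pw_norm
    (composition_op (\<lambda>z. complex_of_real c * z + d))" by (simp add: T_def)
qed

end
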